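(* Let $(X,f_{1,\infty})$ be a non-autonomous discrete system with $f_{1,\infty}$ feeble open and surjective and converging uniformly to a map $f$. If $\{f_n^{n+k}\}_{k\in\mathbb{N}}$ converges collectively to $\{f^k\}_{k\in\mathbb{N}}$, then $(X,f_{1,\infty})$ is totally transitive if and only if $(X,f)$ is totally transitive.
   Context: $\mathbb{N}=\{1,2,3,\dots\}$. A non-autonomous discrete system $(X,f_{1,\infty})$ consists of a compact metric space $(X,d)$ and a sequence $f_{1,\infty}=\{f_n\}_{n=1}^\infty$ of continuous maps $f_n:X\to X$. For $i,n\in\mathbb{N}$, $f_i^n:=f_{i+(n-1)}\circ\cdots\circ f_i$ (a composition of $n$ maps), and $f_i^0=id_X$. The autonomous system $(X,f)$ is the special case $f_n=f$ for all $n$. For $s\in\mathbb{N}$, the $s$-th iterate of the system is $f_{1,\infty}^{[s]}:=\{f_{s(n-1)+1}^s\}_{n=1}^\infty$ (so the composition of its first $n$ maps is $f_1^{sn}$). Uniform convergence of $f_{1,\infty}$ to $f:X\to X$ means $D(f_n,f)\to 0$, where $D(g,h)=\sup_{x\in X}d(g(x),h(x))$. "$\{f_n^{n+k}\}_{k\in\mathbb{N}}$ converges collectively to $\{f^k\}_{k\in\mathbb{N}}$" means: for every $\varepsilon>0$ there exists $r_0\in\mathbb{N}$ such that $D(f_r^k,f^k)<\varepsilon$ for all $r\ge r_0$ and all $k\in\mathbb{N}$, where $f_r^k=f_{r+k-1}\circ\cdots\circ f_r$ and $f^k$ is the $k$-fold composition of $f$. $f_{1,\infty}$ is surjective if every $f_i$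 is surjective. It is feeble open if $\mathrm{int}(f_i(U))\neq\emptyset$ for every nonempty open $U\subseteq X$ and every $i\in\mathbb{N}$. The system $(X,f_{1,\infty})$ is transitive if for any two nonempty open subsets $U,V\subseteq X$ there exists $n\in\mathbb{N}$ such that $f_1^n(U)\cap V\neq\emptyset$. It is totally transitive if $f_{1,\infty}^{[s]}$ is transitive for every $s\in\mathbb{N}$. *)

theory Defs
  imports "HOL-Analysis.Analysis"
begin

text \<open>
  The space \<open>X\<close> is the type universe. Sequences of maps are indexed by the positive
  integers: the value at index 0 is junk, and all notions below ignore it.
\<close>

definition nds :: "(nat \<Rightarrow> 'a::metric_space \<Rightarrow> 'a) \<Rightarrow> bool" where
  "nds F \<longleftrightarrow> compact (UNIV :: 'a set) \<and> (\<forall>n\<ge>1. continuous_on UNIV (F n))"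

text \<open>\<open>nds_comp F i n\<close> is \<open>f\<^sub>i\<^sup>n\<close>, the composition of the \<open>n\<close> maps starting with \<open>F i\<close>.\<close>

primrec nds_comp :: "(nat \<Rightarrow> 'a \<Rightarrow> 'a) \<Rightarrow> nat \<Rightarrow> nat \<Rightarrow> 'a \<Rightarrow> 'a" where
  "nds_comp F i 0 = id"
| "nds_comp F i (Suc n) = F (i + n) \<circ> nds_comp F i n"

definition nds_iterate :: "(nat \<Rightarrow> 'a \<Rightarrow> 'a) \<Rightarrow> nat \<Rightarrow> nat \<Rightarrow> 'a \<Rightarrow> 'a" where
  "nds_iterate F s = (\<lambda>n. nds_comp F (s * (n - 1) + 1) s)"

definition autonomous :: "('a \<Rightarrow> 'a) \<Rightarrow> nat \<Rightarrow> 'a \<Rightarrow> 'a" where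
  "autonomous f = (\<lambda>n. f)"

text \<open>The supremum is genuine (the set of distances is bounded) when the space is compact.\<close>

definition sup_dist :: "('a \<Rightarrow> 'a) \<Rightarrow> ('a \<Rightarrow> 'a::metric_space) \<Rightarrow> real" where
  "sup_dist g h = (SUP x. dist (g x) (h x))"

definition converges_uniformly :: "(nat \<Rightarrow> 'a \<Rightarrow> 'a) \<Rightarrow> ('a \<Rightarrow> 'a::metric_space) \<Rightarrow> bool" where
  "converges_uniformly F f \<longleftrightarrow> (\<lambda>n. sup_dist (F n) f) \<longlonglongrightarrow> 0"

definition converges_collectively :: "(nat \<Rightarrow> 'a \<Rightarrow> 'a) \<Rightarrow> ('a \<Rightarrow> 'a::metric_space) \<Rightarrow> bool" where
  "converges_collectively F f \<longleftrightarrow>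
    (\<forall>\<epsilon>>0. \<exists>r0\<ge>1. \<forall>r\<ge>r0. \<forall>k\<ge>1. sup_dist (nds_comp F r k) (f ^^ k) < \<epsilon>)"

definition nds_surjective :: "(nat \<Rightarrow> 'a \<Rightarrow> 'a) \<Rightarrow> bool" where
  "nds_surjective F \<longleftrightarrow> (\<forall>i\<ge>1. surj (F i))"

definition feeble_open :: "(nat \<Rightarrow> 'a \<Rightarrow> 'a::topological_space) \<Rightarrow> bool" where
  "feeble_open F \<longleftrightarrow> (\<forall>i\<ge>1. \<forall>U. open U \<and> U \<noteq> {} \<longrightarrow> interior (F i ` U) \<noteq> {})"

definition transitive :: "(nat \<Rightarrow> 'a \<Rightarrow> 'a::topological_space) \<Rightarrow> bool" where
  "transitive F \<longleftrightarrow> (\<forall>U V. open U \<and> U \<noteq> {} \<and> open V \<and> V \<noteq> {} \<longrightarrow>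
    (\<exists>n\<ge>1. nds_comp F 1 n ` U \<inter> V \<noteq> {}))"

definition totally_transitive :: "(nat \<Rightarrow> 'a \<Rightarrow> 'a::topological_space) \<Rightarrow> bool" where
  "totally_transitive F \<longleftrightarrow> (\<forall>s\<ge>1. transitive (nds_iterate F s))"

end

theory Submission
  imports Defs
begin

text \<open>
  By collective convergence, beyond some time \<open>s m\<close> every orbit segment of the system, of whatever
  length, is \<open>\<epsilon>\<close>-shadowed by the orbit of the limit map with the same starting point. Feeble
  openness moves a given open set forward to time \<open>s m\<close>, and surjectivity together with continuity
  pulls it back. When pulling back, the hitting time has to exceed \<open>s m\<close>; this is enforced by
  applying transitivity to the iterate of order \<open>s (m + 1)\<close> instead of \<open>s\<close>.
\<close>

lemma nds_comp_add:
  "nds_comp F i (m + n) = nds_comp F (i + m) n \<circ> nds_comp F i m"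
  by (induction n) (auto simp: add.assoc)

lemma nds_comp_iterate: "nds_comp (nds_iterate F s) 1 n = nds_comp F 1 (s * n)"
proof (induction n)
  case (Suc n)
  have "nds_comp F 1 (s * Suc n) = nds_comp F 1 (s * n + s)"
    by (simp add: add.commute)
  then show ?case
    using Suc by (simp add: nds_comp_add nds_iterate_def)
qed simp

lemma nds_comp_autonomous: "nds_comp (autonomous f) i n = f ^^ n"
  by (induction n) (auto simp: autonomous_def)

text \<open>Passing to the \<open>s\<close>-th iterate only restricts the hitting times to multiples
  of \<open>s\<close>, so both directions can work with the original sequence.\<close>

lemma totally_transitive_iff:
  "totally_transitive F \<longleftrightarrow>
    (\<forall>s\<ge>1. \<forall>U V. open U \<and> U \<noteq> {} \<and> open V \<and> V \<noteq> {} \<longrightarrow>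
      (\<exists>n\<ge>1. nds_comp F 1 (s * n) ` U \<inter> V \<noteq> {}))"
  unfolding totally_transitive_def transitive_def nds_comp_iterate ..

lemma continuous_on_nds_comp:
  assumes "nds F" "i \<ge> 1"
  shows "continuous_on UNIV (nds_comp F i n)"
proof (induction n)
  case (Suc n)
  have "continuous_on UNIV (F (i + n))"
    using assms by (simp add: nds_def)
  then show ?case
    unfolding nds_comp.simps
    by (intro continuous_on_compose[OF Suc]) (rule continuous_on_subset, auto)
qed (simp add: id_def)

lemma surj_nds_comp:
  assumes "nds_surjective F" "i \<ge> 1"
  shows "surj (nds_comp F i n)"
proof (induction n)
  case (Suc n)
  have "surj (F (i + n))"
    using assms by (simp add: nds_surjective_def)
  then show ?case
    using Suc comp_surj unfolding nds_comp.simps by blast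
qed simp

lemma interior_nds_comp_image:
  assumes "feeble_open F" "i \<ge> 1" "open U" "U \<noteq> {}"
  shows "interior (nds_comp F i n ` U) \<noteq> {}"
proof (induction n)
  case 0
  then show ?case using assms by (simp add: interior_open)
next
  case (Suc n)
  \<comment> \<open>Feeble openness applies to open sets only and the image of \<open>U\<close> need
    not be open, so the induction continues from its interior.\<close>
  have "interior (F (i + n) ` interior (nds_comp F i n ` U)) \<noteq> {}"
    using assms Suc by (auto simp: feeble_open_def)
  moreover have "F (i + n) ` interior (nds_comp F i n ` U) \<subseteq> nds_comp F i (Suc n) ` U"
    using interior_subset[of "nds_comp F i n ` U"] by (auto simp: image_comp[symmetric])
  ultimately show ?case
    using interior_mono by blast
qed

text \<open>Compactness bounds all distances, so the supremum is a genuine upper bound.\<close>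

lemma dist_le_sup_dist:
  fixes g h :: "'a::metric_space \<Rightarrow> 'a"
  assumes "compact (UNIV :: 'a set)"
  shows "dist (g x) (h x) \<le> sup_dist g h"
  unfolding sup_dist_def
proof (rule cSUP_upper)
  have "bounded (UNIV :: 'a set)"
    using assms by (rule compact_imp_bounded)
  then obtain B where "\<And>x y :: 'a. dist x y \<le> B"
    unfolding bounded_two_points by auto
  then show "bdd_above (range (\<lambda>x. dist (g x) (h x)))"
    by (intro bdd_aboveI[of _ B]) auto
qed simp

lemma converges_collectivelyD:
  fixes F :: "nat \<Rightarrow> 'a::metric_space \<Rightarrow> 'a"
  assumes "compact (UNIV :: 'a set)" "converges_collectively F f" "\<epsilon> > 0"
  obtains r0 where "\<And>r k x. r \<ge> r0 \<Longrightarrow> k \<ge> 1 \<Longrightarrow> dist (nds_comp F r k x) ((f ^^ k) x) < \<epsilon>"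
proof -
  obtain r0 where "\<forall>r\<ge>r0. \<forall>k\<ge>1. sup_dist (nds_comp F r k) (f ^^ k) < \<epsilon>"
    using assms(2,3) unfolding converges_collectively_def by blast
  then show thesis
    using that dist_le_sup_dist[OF assms(1)] le_less_trans by blast
qed

text \<open>Halving the radius of a ball inside \<open>V\<close> leaves room for the shadowing
  error: if one orbit comes \<open>\<epsilon>\<close>-close to \<open>v\<close>, the orbit shadowing
  it ends in \<open>V\<close>.\<close>

lemma open_contains_double_ball:
  fixes V :: "'a::metric_space set"
  assumes "open V" "V \<noteq> {}"
  obtains v \<epsilon> where "\<epsilon> > 0" "\<And>y z. dist v y < \<epsilon> \<Longrightarrow> dist y z < \<epsilon> \<Longrightarrow> z \<in> V"
proof -
  obtain v e where e: "e > 0" "ball v e \<subseteq> V"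
    using assms open_contains_ball by blast
  show thesis
  proof (rule that[of "e / 2" v])
    fix y z assume "dist v y < e / 2" "dist y z < e / 2"
    then have "z \<in> ball v e"
      using dist_triangle[of v z y] by simp
    then show "z \<in> V" using e by blast
  qed (use e in simp)
qed

lemma totally_transitive_if_limit:
  fixes F :: "nat \<Rightarrow> 'a::metric_space \<Rightarrow> 'a"
  assumes "compact (UNIV :: 'a set)" "feeble_open F" "converges_collectively F f"
    and "totally_transitive (autonomous f)"
  shows "totally_transitive F"
  unfolding totally_transitive_iff
proof (intro allI impI; elim conjE)
  fix s :: nat and U V :: "'a set"
  assume s: "s \<ge> 1" and U: "open U" "U \<noteq> {}" and V: "open V" "V \<noteq> {}"
  obtain v \<epsilon> where \<epsilon>: "\<epsilon> > 0" "\<And>y z. dist v y < \<epsilon> \<Longrightarrow> dist y z < \<epsilon> \<Longrightarrow> z \<in> V"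
    by (rule open_contains_double_ball[OF V]) (rule that)
  obtain m where m: "\<And>r k x. r \<ge> m \<Longrightarrow> k \<ge> 1 \<Longrightarrow> dist (nds_comp F r k x) ((f ^^ k) x) < \<epsilon>"
    by (rule converges_collectivelyD[OF assms(1,3) \<epsilon>(1)]) (rule that)
  \<comment> \<open>The waiting time is \<open>s * m\<close> rather than \<open>m\<close>, so that
    the total time stays a multiple of \<open>s\<close>.\<close>
  have "interior (nds_comp F 1 (s * m) ` U) \<noteq> {}"
    using interior_nds_comp_image[OF assms(2) _ U] by simp
  moreover have "ball v \<epsilon> \<noteq> {}" using \<epsilon>(1) by simp
  ultimately obtain n where n: "n \<ge> 1"
    and "(f ^^ (s * n)) ` interior (nds_comp F 1 (s * m) ` U) \<inter> ball v \<epsilon> \<noteq> {}"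
    using assms(4) s unfolding totally_transitive_iff nds_comp_autonomous
    by (meson open_ball open_interior)
  then obtain u where u: "u \<in> U" and "dist v ((f ^^ (s * n)) (nds_comp F 1 (s * m) u)) < \<epsilon>"
    using interior_subset by fastforce
  \<comment> \<open>The first \<open>s * m\<close> maps are used up, so the shadowed segment starts
    at index \<open>1 + s * m\<close>; this is late enough because \<open>s\<close> is
    positive.\<close>
  moreover have "m \<le> 1 + s * m" "1 \<le> s * n"
    using s n by (cases s; simp)+
  ultimately have "nds_comp F (1 + s * m) (s * n) (nds_comp F 1 (s * m) u) \<in> V"
    using \<epsilon>(2) m by (metis dist_commute)
  then have "nds_comp F 1 (s * (m + n)) u \<in> V"
    by (simp add: nds_comp_add distrib_left)
  then show "\<exists>n\<ge>1. nds_comp F 1 (s * n) ` U \<inter> V \<noteq> {}"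
    using u n by (intro exI[of _ "m + n"]) auto
qed

lemma totally_transitive_limit:
  fixes F :: "nat \<Rightarrow> 'a::metric_space \<Rightarrow> 'a"
  assumes "nds F" "nds_surjective F" "converges_collectively F f" "totally_transitive F"
  shows "totally_transitive (autonomous f)"
  unfolding totally_transitive_iff nds_comp_autonomous
proof (intro allI impI; elim conjE)
  fix s :: nat and U V :: "'a set"
  assume s: "s \<ge> 1" and U: "open U" "U \<noteq> {}" and V: "open V" "V \<noteq> {}"
  obtain v \<epsilon> where \<epsilon>: "\<epsilon> > 0" "\<And>y z. dist v y < \<epsilon> \<Longrightarrow> dist y z < \<epsilon> \<Longrightarrow> z \<in> V"
    by (rule open_contains_double_ball[OF V]) (rule that)
  have "compact (UNIV :: 'a set)" using assms(1) by (simp add: nds_def)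
  note collective = converges_collectivelyD[OF this assms(3) \<epsilon>(1)]
  obtain m where m: "\<And>r k x. r \<ge> m \<Longrightarrow> k \<ge> 1 \<Longrightarrow> dist (nds_comp F r k x) ((f ^^ k) x) < \<epsilon>"
    by (rule collective) (rule that)
  \<comment> \<open>\<open>W\<close> consists of the points that lie in \<open>U\<close> at time
    \<open>s * m\<close>: it is open by continuity and nonempty by surjectivity.\<close>
  define W where "W = nds_comp F 1 (s * m) -` U"
  have "open W"
    unfolding W_def using continuous_on_nds_comp[OF assms(1)] U(1) by (simp add: open_vimage)
  moreover have "W \<noteq> {}"
    unfolding W_def using surj_nds_comp[OF assms(2), of 1 "s * m"] U(2)
    by (metis image_empty order_refl surj_image_vimage_eq)
  moreover have "ball v \<epsilon> \<noteq> {}" using \<epsilon>(1) by simp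
  \<comment> \<open>A positive multiple of \<open>s * (m + 1)\<close> exceeds \<open>s * m\<close>,
    so the hit occurs after the orbit has passed through \<open>U\<close>.\<close>
  moreover have "s * (m + 1) \<ge> 1" using s by simp
  ultimately obtain n where n: "n \<ge> 1"
    and "nds_comp F 1 (s * (m + 1) * n) ` W \<inter> ball v \<epsilon> \<noteq> {}"
    using assms(4) unfolding totally_transitive_iff by (meson open_ball)
  then obtain w where w: "w \<in> W" and dw: "dist v (nds_comp F 1 (s * (m + 1) * n) w) < \<epsilon>"
    by auto
  \<comment> \<open>\<open>k\<close> counts the blocks of length \<open>s\<close> left after time
    \<open>s * m\<close>. Since \<open>n\<close> is positive, the subtraction is not truncated and
    \<open>k\<close> is at least 1.\<close>
  define k where "k = (m + 1) * n - m"
  have "(m + 1) * n \<ge> m + 1" using n by (cases n) auto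
  then have k: "k \<ge> 1" "(m + 1) * n = m + k" by (auto simp: k_def)
  then have "s * (m + 1) * n = s * m + s * k"
    by (metis distrib_left mult.assoc)
  with dw have "dist v (nds_comp F (1 + s * m) (s * k) (nds_comp F 1 (s * m) w)) < \<epsilon>"
    by (simp add: nds_comp_add)
  moreover have "m \<le> 1 + s * m" "1 \<le> s * k"
    using s k(1) by (cases s; simp)+
  \<comment> \<open>Here the orbit of the system is the one known to be near \<open>v\<close>, and
    the orbit of \<open>f\<close> from the same point of \<open>U\<close> follows it into
    \<open>V\<close>.\<close>
  ultimately have "(f ^^ (s * k)) (nds_comp F 1 (s * m) w) \<in> V"
    using \<epsilon>(2) m by blast
  then show "\<exists>n\<ge>1. (f ^^ (s * n)) ` U \<inter> V \<noteq> {}"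
    using w k(1) unfolding W_def by blast
qed

theorem theorem11:
  fixes F :: "nat \<Rightarrow> 'a::metric_space \<Rightarrow> 'a" and f :: "'a \<Rightarrow> 'a"
  assumes "nds F"
    and "feeble_open F"
    and "nds_surjective F"
    and "converges_uniformly F f"
    and "converges_collectively F f"
  shows "totally_transitive F \<longleftrightarrow> totally_transitive (autonomous f)"
  using totally_transitive_limit[OF assms(1,3,5)] totally_transitive_if_limit[OF _ assms(2,5)] assms(1)
  by (auto simp: nds_def)

end
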